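(* Let $X$ be a real or complex Banach space and let $(A(n))_{n\in\mathbb{N}}$ be a sequence in $\mathcal{B}(X)$. The linear discrete-time system $x_{n+1}=A(n)x_n$, $n\in\mathbb{N}$, is nonuniformly power instable (NPIS) if and only if there exists a nondecreasing sequence $\theta:\mathbb{N}\to[1,\infty)$ such that $$\sum_{k=n}^{m}\|\mathcal{A}(k,n)x\|\le \theta(m)\,\|\mathcal{A}(m,n)x\|$$ for all $(m,n,x)\in\Delta\times X$.
   Context: $\mathcal{B}(X)$ is the space of bounded linear operators on $X$; $\|\cdot\|$ denotes the norm on $X$. $\mathbb{N}=\{0,1,2,\dots\}$ and $\Delta=\{(m,n)\in\mathbb{N}^2: m\ge n\}$. For $(m,n)\in\Delta$, $\mathcal{A}(m,n)=A(m-1)\cdots A(n)$ if $m\ge n+1$ and $\mathcal{A}(n,n)=I$ (the identity). The system is nonuniformly power instable (NPIS) if there exist a nondecreasing sequence $N:\mathbb{N}\to[1,\infty)$ and $r\in(0,1)$ such that $\|\mathcal{A}(n,l)x\|\le N(m)\,r^{m-n}\,\|\mathcal{A}(m,l)x\|$ for all $m,n,l\in\mathbb{N}$ with $m\ge n\ge l$ and all $x\in X$. *)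

theory Defs
  imports "HOL-Analysis.Analysis"
begin

text \<open>
  The state space is a type of class \<open>banach\<close>, i.e. a real Banach space, and \<open>\<Rightarrow>\<^sub>L\<close> is the space of
  bounded real-linear operators. A complex Banach space is also a real one, with the same norm, and
  its bounded complex-linear operators are bounded real-linear; since scalars do not occur in the
  notions below, the complex case is an instance of the real one.
\<close>

text \<open>
  The product \<open>A (m - 1) \<dots> A n\<close>, with the factors in this order; it is the identity for \<open>m = n\<close>.
  It is only meaningful for \<open>n \<le> m\<close>, so every use is guarded by that condition.
\<close>

definition evolution ::
  "(nat \<Rightarrow> 'a::banach \<Rightarrow>\<^sub>L 'a) \<Rightarrow> nat \<Rightarrow> nat \<Rightarrow> 'a \<Rightarrow>\<^sub>L 'a" where
  "evolution A m n = foldr (\<lambda>k B. A k o\<^sub>L B) (rev [n..<m]) id_blinfun"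

lemma evolution_refl [simp]: "evolution A n n = id_blinfun"
  by (simp add: evolution_def)

lemma evolution_Suc: "n \<le> m \<Longrightarrow> evolution A (Suc m) n = A m o\<^sub>L evolution A m n"
  by (simp add: evolution_def)

definition NPIS :: "(nat \<Rightarrow> 'a::banach \<Rightarrow>\<^sub>L 'a) \<Rightarrow> bool" where
  "NPIS A \<longleftrightarrow> (\<exists>(N :: nat \<Rightarrow> real) (r :: real).
     mono N \<and> (\<forall>n. 1 \<le> N n) \<and> 0 < r \<and> r < 1 \<and>
     (\<forall>m n l x. l \<le> n \<and> n \<le> m \<longrightarrow>
        norm (blinfun_apply (evolution A n l) x)
          \<le> N m * r ^ (m - n) * norm (blinfun_apply (evolution A m l) x)))"

end

theory Submission
  imports Defs
begin

text \<open>
  Write \<open>a k\<close> for the norm of \<open>evolution A k n x\<close>. Under NPIS the terms \<open>a k\<close> decay geometrically,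
  up to the factor \<open>N m\<close>, as \<open>k\<close> decreases from \<open>m\<close>, so that their sum is at most
  \<open>N m / (1 - r) * a m\<close>.

  Conversely, dropping all terms but one from the sum leaves \<open>a k \<le> \<theta> m * a m\<close> for \<open>n \<le> k \<le> m\<close>,
  with no decay. None is needed, because \<open>N\<close> may grow arbitrarily fast with the later time \<open>m\<close>:
  as \<open>r ^ m \<le> r ^ (m - k)\<close>, the choice \<open>N m = \<theta> m / r ^ m\<close> makes up for the factor \<open>r ^ (m - k)\<close>,
  whatever \<open>r\<close> is. Accordingly \<open>r = 1/2\<close> and \<open>N m = \<theta> m * 2 ^ m\<close> are taken below.
\<close>

lemma sum_le_of_backward_geometric_decay:
  fixes a :: "nat \<Rightarrow> real"
  assumes r: "0 < r" "r < 1" and nonneg: "0 \<le> C" "0 \<le> a m"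
    and decay: "\<And>k. n \<le> k \<Longrightarrow> k \<le> m \<Longrightarrow> a k \<le> C * r ^ (m - k) * a m"
  shows "(\<Sum>k=n..m. a k) \<le> C / (1 - r) * a m"
proof -
  have "(\<Sum>k=n..m. r ^ (m - k)) \<le> (\<Sum>k\<le>m. r ^ (m - k))"
    using r by (intro sum_mono2) auto
  also have "\<dots> = (\<Sum>j\<le>m. r ^ j)"
    by (rule sum.nat_diff_reindex[where n = "Suc m" and g = "\<lambda>j. r ^ j", simplified lessThan_Suc_atMost, simplified])
  also have "\<dots> \<le> (\<Sum>j. r ^ j)"
    using r by (intro sum_le_suminf summable_geometric) auto
  also have "\<dots> = 1 / (1 - r)"
    using r by (intro suminf_geometric) auto
  finally have geometric: "(\<Sum>k=n..m. r ^ (m - k)) \<le> 1 / (1 - r)" .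
  have "(\<Sum>k=n..m. a k) \<le> (\<Sum>k=n..m. C * a m * r ^ (m - k))"
    using decay by (intro sum_mono) (simp add: mult_ac)
  also have "\<dots> = C * a m * (\<Sum>k=n..m. r ^ (m - k))"
    by (simp add: sum_distrib_left)
  also have "\<dots> \<le> C * a m * (1 / (1 - r))"
    using geometric nonneg by (intro mult_left_mono) auto
  finally show ?thesis by simp
qed

theorem corollary8:
  fixes A :: "nat \<Rightarrow> 'a::banach \<Rightarrow>\<^sub>L 'a"
  shows "NPIS A \<longleftrightarrow>
    (\<exists>\<theta> :: nat \<Rightarrow> real. mono \<theta> \<and> (\<forall>n. 1 \<le> \<theta> n) \<and>
       (\<forall>m n x. n \<le> m \<longrightarrow>
          (\<Sum>k=n..m. norm (blinfun_apply (evolution A k n) x))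
            \<le> \<theta> m * norm (blinfun_apply (evolution A m n) x)))"
    (is "_ \<longleftrightarrow> ?summation")
proof
  assume "NPIS A"
  then obtain N r where N: "mono N" "\<And>n. 1 \<le> N n" and r: "0 < r" "r < 1"
    and decay: "\<And>m n l x. l \<le> n \<Longrightarrow> n \<le> m \<Longrightarrow>
      norm (evolution A n l x) \<le> N m * r ^ (m - n) * norm (evolution A m l x)"
    unfolding NPIS_def by metis
  have N_nonneg: "0 \<le> N m" for m
    using N(2)[of m] by simp
  show ?summation
  proof (intro exI[of _ "\<lambda>m. N m / (1 - r)"] conjI allI impI)
    show "mono (\<lambda>m. N m / (1 - r))"
      using N(1) r by (auto simp: mono_def intro: divide_right_mono)
    show "1 \<le> N n / (1 - r)" for n
      using N(2)[of n] r by simp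
    show "(\<Sum>k=n..m. norm (evolution A k n x)) \<le> N m / (1 - r) * norm (evolution A m n x)"
      for m n x
      by (rule sum_le_of_backward_geometric_decay[OF r N_nonneg norm_ge_zero decay])
  qed
next
  assume ?summation
  then obtain \<theta> :: "nat \<Rightarrow> real" where \<theta>: "mono \<theta>" "\<And>n. 1 \<le> \<theta> n"
    and sum_le: "\<And>m n x. n \<le> m \<Longrightarrow>
      (\<Sum>k=n..m. norm (evolution A k n x)) \<le> \<theta> m * norm (evolution A m n x)"
    by metis
  have \<theta>_nonneg: "0 \<le> \<theta> m" for m
    using \<theta>(2)[of m] by simp
  show "NPIS A"
    unfolding NPIS_def
  proof (intro exI[of _ "\<lambda>m. \<theta> m * 2 ^ m"] exI[of _ "1/2"] conjI allI impI; (elim conjE)?)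
    show "mono (\<lambda>m. \<theta> m * 2 ^ m)"
      using \<theta>(1) \<theta>_nonneg by (auto simp: mono_def intro!: mult_mono)
    show "1 \<le> \<theta> m * 2 ^ m" for m
      using mult_mono[OF \<theta>(2)[of m] one_le_power[of "2::real" m]] \<theta>_nonneg[of m] by simp
    show "norm (evolution A n l x) \<le> \<theta> m * 2 ^ m * (1/2) ^ (m - n) * norm (evolution A m l x)"
      if "l \<le> n" "n \<le> m" for m n l x
    proof -
      have "norm (evolution A n l x) \<le> (\<Sum>k=l..m. norm (evolution A k l x))"
        using that by (intro member_le_sum) auto
      also have "\<dots> \<le> \<theta> m * norm (evolution A m l x)"
        using that by (intro sum_le) simp
      also have "\<dots> \<le> 2 ^ n * (\<theta> m * norm (evolution A m l x))"
        using mult_right_mono[OF one_le_power[of "2::real" n], of "\<theta> m * norm (evolution A m l x)"]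
          \<theta>_nonneg[of m] by simp
      also have "(2::real) ^ n = 2 ^ m * (1/2) ^ (m - n)"
        using that by (simp add: power_diff power_one_over)
      finally show ?thesis by (simp add: mult_ac)
    qed
  qed simp_all
qed

end
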